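(* For a finite semigroup $S$, the following statements are equivalent: (1) $\mathbf{C}(S)$ is a group; (2) $\mathbf{C}(S)$ is trivial (has exactly one element); (3) $S$ is an inflation of a right zero semigroup by null semigroups.
   Context: Cayley automaton semigroup: for a finite (non-empty) semigroup $S$, the Cayley automaton $\mathcal{C}(S)$ has state set $S$ and alphabet $S$; when in state $s$ (written $\overline{s}$ to distinguish states from symbols) and reading a symbol $t$, it outputs $st$ and moves to state $\overline{st}$. Thus each state defines a transformation $\overline{s}$ of the set $S^{\infty}$ of infinite sequences over $S$, given by $(x_1,x_2,x_3,\ldots)\cdot\overline{s}=(sx_1,\,sx_1x_2,\,sx_1x_2x_3,\ldots)$. Transformations act on the right and are composed left to right: $\alpha\cdot(\overline{s}\cdot\overline{t})=(\alpha\cdot\overline{s})\cdot\overline{t}$. $\mathbf{C}(S)$ is the semigroup of transformations of $S^{\infty}$ generated by $\{\overline{s}:s\in S\}$. A right zero semigroup is one satisfying $xy=y$ for all $x,y$. A semigroup $S$ is an inflation of a right zero semigroup $T$ by null semigroups if $T$ is a subsemigroup of $S$ and $S$ can be partitioned into disjoint subsets $S_t$ ($t\in T$) such that $t\in S_t$ for all $t\in T$ and $S_uS_t=\{t\}$ for all $t,u\in T$. *)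

theory Defs
  imports "HOL-Algebra.Group" "HOL-Library.Set_Algebras" "HOL-Library.Disjoint_Sets"
begin

text \<open>
  A finite non-empty semigroup \<open>S\<close> is a type \<open>'a\<close> of sort \<open>{finite, semigroup_mult}\<close>.
  The infinite sequence \<open>(x\<^sub>1, x\<^sub>2, x\<^sub>3, \<dots>)\<close> is the function
  \<open>x :: nat \<Rightarrow> 'a\<close> indexed from \<open>0\<close>.
  A constant that depends on \<open>S\<close> alone takes the argument \<open>TYPE('a)\<close>.
\<close>

definition cayley_next :: "'a::semigroup_mult \<Rightarrow> 'a \<Rightarrow> 'a" where
  "cayley_next q t = q * t"

definition cayley_output :: "'a::semigroup_mult \<Rightarrow> 'a \<Rightarrow> 'a" where
  "cayley_output q t = q * t"

text \<open>\<open>cayley_state s x n\<close> is the state after reading \<open>n\<close> symbols of \<open>x\<close>, starting in \<open>s\<close>.\<close>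

primrec cayley_state :: "'a::semigroup_mult \<Rightarrow> (nat \<Rightarrow> 'a) \<Rightarrow> nat \<Rightarrow> 'a" where
  "cayley_state s x 0 = s"
| "cayley_state s x (Suc n) = cayley_next (cayley_state s x n) (x n)"

definition cayley_act :: "'a::semigroup_mult \<Rightarrow> (nat \<Rightarrow> 'a) \<Rightarrow> (nat \<Rightarrow> 'a)" where
  "cayley_act s x = (\<lambda>n. cayley_output (cayley_state s x n) (x n))"

lemma cayley_act_0: "cayley_act s x 0 = s * x 0"
  by (simp add: cayley_act_def cayley_output_def)

lemma cayley_act_Suc: "cayley_act s x (Suc n) = cayley_act s x n * x (Suc n)"
  by (simp add: cayley_act_def cayley_output_def cayley_next_def)

text \<open>Transformations act on the right, so the product \<open>f \<cdot> g\<close> applies \<open>f\<close> first.\<close>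

definition trans_mult :: "('b \<Rightarrow> 'b) \<Rightarrow> ('b \<Rightarrow> 'b) \<Rightarrow> ('b \<Rightarrow> 'b)" where
  "trans_mult f g = g \<circ> f"

inductive_set trans_semigroup_gen :: "('b \<Rightarrow> 'b) set \<Rightarrow> ('b \<Rightarrow> 'b) set"
  for G :: "('b \<Rightarrow> 'b) set" where
  gen: "f \<in> G \<Longrightarrow> f \<in> trans_semigroup_gen G"
| mult: "f \<in> trans_semigroup_gen G \<Longrightarrow> g \<in> trans_semigroup_gen G
           \<Longrightarrow> trans_mult f g \<in> trans_semigroup_gen G"

definition cayley_semigroup :: "'a itself \<Rightarrow> ((nat \<Rightarrow> 'a::semigroup_mult) \<Rightarrow> (nat \<Rightarrow> 'a)) set" where
  "cayley_semigroup TYPE('a) = trans_semigroup_gen (range (cayley_act :: 'a \<Rightarrow> _))"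

text \<open>
  The neutral element of a transformation semigroup that happens to be a group need not be
  the identity transformation, so it is quantified existentially.
\<close>

definition trans_semigroup_is_group :: "('b \<Rightarrow> 'b) set \<Rightarrow> bool" where
  "trans_semigroup_is_group C \<longleftrightarrow>
     (\<exists>e. group \<lparr>carrier = C, monoid.mult = trans_mult, one = e\<rparr>)"

definition subsemigroup :: "'a::semigroup_mult set \<Rightarrow> bool" where
  "subsemigroup T \<longleftrightarrow> T \<noteq> {} \<and> (\<forall>x\<in>T. \<forall>y\<in>T. x * y \<in> T)"

definition right_zero :: "'a::semigroup_mult set \<Rightarrow> bool" where
  "right_zero T \<longleftrightarrow> (\<forall>x\<in>T. \<forall>y\<in>T. x * y = y)"

text \<open>
  \<open>P t\<close> is the block \<open>S\<^sub>t\<close>; the blocks are non-empty because \<open>t \<in> P t\<close>.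
  The product \<open>P u * P t\<close> is the elementwise product of sets.
\<close>

definition inflation_by_null_semigroups :: "'a::semigroup_mult set \<Rightarrow> bool" where
  "inflation_by_null_semigroups T \<longleftrightarrow>
     subsemigroup T \<and>
     (\<exists>P :: 'a \<Rightarrow> 'a set.
        disjoint_family_on P T \<and> (\<Union>t\<in>T. P t) = UNIV \<and>
        (\<forall>t\<in>T. t \<in> P t) \<and>
        (\<forall>t\<in>T. \<forall>u\<in>T. P u * P t = {t}))"

end

(* If C(S) is a group, its identity \<iota> acts on first letters as left multiplication by some i,
   which is then a left identity of K = S S, and s K = K for every s.  Let e = i i and k in K.  The
   sequence (k, e, e, ...) lies in the image of the generators, so \<iota> fixes it.  A generator can
   send a sequence over K to an eventually-e sequence only if that sequence is itself eventually e.
   Reading \<iota> = s_1 ... s_n backwards from (k, e, e, ...) therefore shows that s_1 maps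
   (k, e, e, ...) to an eventually-e sequence, that is s_1 k e = e.  As s_1 K = K, this makes K a
   right zero semigroup, and the fibres of x \<mapsto> i x exhibit S as an inflation of K. *)

theory Submission
  imports Defs
begin

lemma cayley_act_in_cayley_semigroup:
  "cayley_act (s :: 'a::semigroup_mult) \<in> cayley_semigroup TYPE('a)"
  unfolding cayley_semigroup_def by (rule trans_semigroup_gen.gen) simp

lemma comp_in_cayley_semigroup:
  assumes "f \<in> cayley_semigroup TYPE('a::semigroup_mult)" "g \<in> cayley_semigroup TYPE('a)"
  shows "g \<circ> f \<in> cayley_semigroup TYPE('a)"
  using assms unfolding cayley_semigroup_def
  by (metis trans_semigroup_gen.mult trans_mult_def)

lemma cayley_semigroup_induct [consumes 1, case_names gen comp]:
  assumes "f \<in> cayley_semigroup TYPE('a::semigroup_mult)"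
    and "\<And>s. Q (cayley_act (s :: 'a))"
    and "\<And>f g. Q f \<Longrightarrow> Q g \<Longrightarrow> Q (g \<circ> f)"
  shows "Q f"
  using assms(1) unfolding cayley_semigroup_def
proof (induction rule: trans_semigroup_gen.induct)
  case (gen f)
  then show ?case using assms(2) by blast
next
  case (mult f g)
  then show ?case unfolding trans_mult_def using assms(3) by blast
qed

text \<open>Multipliers of composed maps multiply up. Comparing first letters thus turns equations
  between transformations into equations in the semigroup.\<close>

lemma cayley_semigroup_first_letter:
  assumes "f \<in> cayley_semigroup TYPE('a::semigroup_mult)"
  shows "\<exists>m. \<forall>x. f x 0 = m * x 0"
  using assms
proof (induction rule: cayley_semigroup_induct)
  case (gen s)
  show ?case by (auto simp: cayley_act_0)
next
  case (comp f g)
  then obtain m m' where "\<forall>x. f x 0 = m * x 0" "\<forall>x. g x 0 = m' * x 0" by blast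
  then have "\<forall>x. (g \<circ> f) x 0 = (m' * m) * x 0" by (simp add: mult.assoc)
  then show ?case by blast
qed

lemma cayley_act_in_products:
  "cayley_act s x n \<in> (UNIV * UNIV :: 'a::semigroup_mult set)"
  by (cases n) (auto simp: cayley_act_0 cayley_act_Suc intro: set_times_intro)

text \<open>Two consecutive outputs \<open>e\<close> force \<open>e * z (Suc n) = e\<close>, and
  \<open>e\<close> cancels because it is a left identity on the letters of \<open>z\<close>.\<close>

lemma cayley_act_eventually_eq_imp:
  fixes e :: "'a::semigroup_mult"
  assumes e: "\<And>y. y \<in> K \<Longrightarrow> e * y = y" and z: "range z \<subseteq> K"
    and ev: "\<forall>\<^sub>F n in sequentially. cayley_act s z n = e"
  shows "\<forall>\<^sub>F n in sequentially. z n = e"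
proof -
  from ev obtain N where N: "\<And>n. n \<ge> N \<Longrightarrow> cayley_act s z n = e"
    by (auto simp: eventually_sequentially)
  have "z (Suc n) = e" if "n \<ge> N" for n
  proof -
    have "e * z (Suc n) = e"
      using N[of n] N[of "Suc n"] that by (simp add: cayley_act_Suc)
    then show ?thesis using e z by (metis range_subsetD)
  qed
  then have "\<forall>\<^sub>F n in sequentially. z (Suc n) = e"
    by (auto simp: eventually_sequentially)
  then show ?thesis by (rule eventually_sequentially_Suc[THEN iffD1])
qed

text \<open>The witness \<open>s\<close> below is the first generator in a factorization of \<open>f\<close>.\<close>

lemma cayley_semigroup_eventually_eq_imp:
  fixes e :: "'a::semigroup_mult"
  assumes "f \<in> cayley_semigroup TYPE('a)"
    and e: "\<And>y. y \<in> UNIV * UNIV \<Longrightarrow> e * y = y"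
  obtains s where "\<And>z. range z \<subseteq> UNIV * UNIV \<Longrightarrow> \<forall>\<^sub>F n in sequentially. f z n = e
    \<Longrightarrow> \<forall>\<^sub>F n in sequentially. cayley_act s z n = e"
proof -
  define D where "D = {z :: nat \<Rightarrow> 'a. range z \<subseteq> UNIV * UNIV}"
  define E where "E = {z. \<forall>\<^sub>F n in sequentially. z n = e}"
  \<comment> \<open>The first conjunct makes the induction work: if \<open>g (f z)\<close> is in
    \<open>E\<close>, then so is \<open>f z\<close>, since it lies in \<open>D\<close>; hence the
    witness for \<open>f\<close> also serves \<open>g \<circ> f\<close>.\<close>
  have "(\<forall>z\<in>D. f z \<in> D \<and> (f z \<in> E \<longrightarrow> z \<in> E)) \<and> (\<exists>s. \<forall>z\<in>D. f z \<in> E \<longrightarrow> cayley_act s z \<in> E)"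
    using assms(1)
  proof (induction rule: cayley_semigroup_induct)
    case (gen s)
    have "cayley_act s z \<in> D" for z
      using cayley_act_in_products by (auto simp: D_def)
    moreover have "z \<in> E" if "z \<in> D" "cayley_act s z \<in> E" for z
      using cayley_act_eventually_eq_imp[OF e] that by (simp add: D_def E_def)
    ultimately show ?case by blast
  next
    case (comp f g)
    then show ?case unfolding o_apply by meson
  qed
  then show ?thesis using that by (auto simp: D_def E_def)
qed

lemma right_zero_inflation_if_group:
  assumes "trans_semigroup_is_group (cayley_semigroup TYPE('a::semigroup_mult))"
  shows "\<exists>T :: 'a set. right_zero T \<and> inflation_by_null_semigroups T"
proof -
  define C where "C = cayley_semigroup TYPE('a)"
  define K where "K = (UNIV * UNIV :: 'a set)"
  have act_C: "cayley_act s \<in> C" for s :: 'a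
    unfolding C_def by (rule cayley_act_in_cayley_semigroup)
  have K_mult: "x * y \<in> K" for x y unfolding K_def by (simp add: set_times_intro)
  have K_cases: "\<exists>a b. x = a * b" if "x \<in> K" for x
    using that by (auto simp: K_def set_times_def)
  obtain \<iota> where grp: "group \<lparr>carrier = C, monoid.mult = trans_mult, one = \<iota>\<rparr>"
    using assms unfolding trans_semigroup_is_group_def C_def by blast
  interpret group "\<lparr>carrier = C, monoid.mult = trans_mult, one = \<iota>\<rparr>" by (fact grp)
  have \<iota>_C: "\<iota> \<in> C" using one_closed by simp
  \<comment> \<open>Products apply the left factor first, so the right unit law says that
    \<open>\<iota>\<close> fixes the image of \<open>f\<close>.\<close>
  have \<iota>_left: "\<iota> (f x) = f x" and \<iota>_right: "f (\<iota> x) = f x" if "f \<in> C" for f x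
    using r_one[of f] l_one[of f] that by (auto simp: trans_mult_def dest: fun_cong)
  obtain i where i: "\<And>x. \<iota> x 0 = i * x 0"
    using cayley_semigroup_first_letter \<iota>_C unfolding C_def by blast
  have i_left: "i * y = y" if y_K: "y \<in> K" for y
  proof -
    obtain s x where y: "y = s * x" using K_cases[OF y_K] by blast
    show ?thesis using fun_cong[OF \<iota>_left[OF act_C, of s "\<lambda>_. x"], of 0]
      by (simp add: i cayley_act_0 y)
  qed
  have i_right: "s * (i * x) = s * x" for s x
    using fun_cong[OF \<iota>_right[OF act_C, of s "\<lambda>_. x"], of 0] by (simp add: i cayley_act_0)
  have solvable: "\<exists>k'\<in>K. s * k' = k" if "k \<in> K" for s k
  proof -
    \<comment> \<open>In ordinary composition, \<open>h\<close> is a right inverse of the generator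
      relative to \<open>\<iota>\<close>; its multiplier \<open>m\<close> yields the solution
      \<open>m * k\<close>.\<close>
    obtain h where h: "h \<in> C" "trans_mult h (cayley_act s) = \<iota>"
      using l_inv_ex[of "cayley_act s"] act_C by auto
    obtain m where m: "\<And>x. h x 0 = m * x 0"
      using cayley_semigroup_first_letter h(1) unfolding C_def by blast
    have "s * (m * k) = i * k"
      using fun_cong[OF fun_cong[OF h(2), of "\<lambda>_. k"], of 0]
      by (simp add: trans_mult_def cayley_act_0 m i)
    then show ?thesis using i_left that K_mult by metis
  qed
  \<comment> \<open>Squaring guarantees a left identity of \<open>K\<close> that itself lies in
    \<open>K\<close>.\<close>
  define e where "e = i * i"
  have e_K: "e \<in> K" unfolding e_def by (rule K_mult)
  have e_left: "e * y = y" if "y \<in> K" for y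
    using i_left that by (simp add: e_def mult.assoc)
  obtain s where s: "\<And>z. range z \<subseteq> K \<Longrightarrow> \<forall>\<^sub>F n in sequentially. \<iota> z n = e
      \<Longrightarrow> \<forall>\<^sub>F n in sequentially. cayley_act s z n = e"
    using cayley_semigroup_eventually_eq_imp \<iota>_C e_left unfolding C_def K_def by metis
  have absorb: "s * k * e = e" if k: "k \<in> K" for k
  proof -
    define x where "x = (\<lambda>n::nat. if n = 0 then k else e)"
    have "\<exists>t z. x = cayley_act t z"
    proof -
      obtain a b where ab: "k = a * b" using K_cases k by blast
      obtain c where c: "k * c = e" using solvable e_K by blast
      \<comment> \<open>The preimage is \<open>(b, c, e, e, ...)\<close>: started in
        \<open>a\<close>, it outputs \<open>a * b = k\<close>, then \<open>k * c = e\<close>, then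
        \<open>e * e = e\<close> forever.\<close>
      define z where "z = (\<lambda>n::nat. if n = 0 then b else if n = 1 then c else e)"
      have "cayley_act a z n = x n" for n
        by (induction n) (auto simp: cayley_act_0 cayley_act_Suc z_def x_def ab[symmetric] c
            e_left e_K)
      then show ?thesis by (metis ext)
    qed
    then have fix_x: "\<iota> x = x" using \<iota>_left act_C by metis
    have "\<forall>\<^sub>F n in sequentially. x n = e"
      by (auto simp: x_def eventually_sequentially intro: exI[of _ 1])
    moreover have "range x \<subseteq> K" using k e_K by (auto simp: x_def)
    ultimately have "\<forall>\<^sub>F n in sequentially. cayley_act s x n = e"
      using s fix_x by simp
    then have "\<forall>\<^sub>F n in sequentially. cayley_act s x (Suc n) = e"
      by (rule eventually_sequentially_Suc[THEN iffD2])
    \<comment> \<open>The output is constant from index 1 on because \<open>e * e = e\<close>, so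
      its eventual value \<open>e\<close> must be \<open>s * k * e\<close>.\<close>
    moreover have "cayley_act s x (Suc n) = s * k * e" for n
      by (induction n) (auto simp: cayley_act_0 cayley_act_Suc x_def mult.assoc e_left e_K)
    ultimately show ?thesis by simp
  qed
  have rz: "x * y = y" if "x \<in> K" "y \<in> K" for x y
  proof -
    \<comment> \<open>Each \<open>x\<close> in \<open>K\<close> has the form \<open>s * k'\<close>
      with \<open>k'\<close> in \<open>K\<close>, so \<open>absorb\<close> applies to it.\<close>
    have "x * e = e" using solvable[OF that(1), of s] absorb by blast
    then show ?thesis using e_left[OF that(2)] by (metis mult.assoc)
  qed
  have "right_zero K" using rz by (simp add: right_zero_def)
  moreover have "inflation_by_null_semigroups K"
    unfolding inflation_by_null_semigroups_def
  proof (intro conjI exI ballI)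
    show "subsemigroup K" using e_K K_mult by (auto simp: subsemigroup_def)
    let ?P = "\<lambda>t. {x. i * x = t}"
    show "disjoint_family_on ?P K" by (auto simp: disjoint_family_on_def)
    show "(\<Union>t\<in>K. ?P t) = UNIV" using K_mult by auto
    show "t \<in> ?P t" if "t \<in> K" for t using i_left that by simp
    show "?P u * ?P t = {t}" if "t \<in> K" "u \<in> K" for t u
    proof -
      have "x * y = t" if "i * x = u" "i * y = t" for x y
      proof -
        \<comment> \<open>By \<open>i_right\<close>, \<open>y\<close> may be replaced by
          \<open>i * y = t\<close>; the product \<open>x * t\<close> lies in \<open>K\<close>, so
          \<open>i\<close> fixes it.\<close>
        have "x * y = i * (x * t)" using i_left i_right that K_mult by metis
        also have "\<dots> = u * t" using that by (simp add: mult.assoc[symmetric])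
        finally show ?thesis using rz \<open>t \<in> K\<close> \<open>u \<in> K\<close> by simp
      qed
      moreover have "u * t \<in> ?P u * ?P t" using i_left \<open>t \<in> K\<close> \<open>u \<in> K\<close> by (auto intro: set_times_intro)
      ultimately show ?thesis using rz[OF that(2,1)] by (auto elim!: set_times_elim)
    qed
  qed
  ultimately show ?thesis by blast
qed

text \<open>A product depends only on the block of its right factor, so all generators coincide with
  one idempotent map.\<close>

lemma card_cayley_semigroup_if_inflation:
  assumes "inflation_by_null_semigroups (T :: 'a::semigroup_mult set)"
  shows "card (cayley_semigroup TYPE('a)) = 1"
proof -
  obtain P where cover: "(\<Union>t\<in>T. P t) = UNIV"
    and prod: "\<And>t u. t \<in> T \<Longrightarrow> u \<in> T \<Longrightarrow> P u * P t = {t}"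
    using assms unfolding inflation_by_null_semigroups_def by blast
  have const: "s * x = s' * x" for s s' x :: 'a
  proof -
    obtain t u u' where "t \<in> T" "x \<in> P t" "u \<in> T" "s \<in> P u" "u' \<in> T" "s' \<in> P u'"
      using cover by blast
    then have "s * x = t" "s' * x = t" using prod set_times_intro by blast+
    then show ?thesis by simp
  qed
  \<comment> \<open>Here \<open>undefined\<close> is just some fixed element; by
    \<open>const\<close> any left factor gives the same map.\<close>
  define F :: "(nat \<Rightarrow> 'a) \<Rightarrow> nat \<Rightarrow> 'a" where "F = (\<lambda>x n. undefined * x n)"
  have act: "cayley_act s = F" for s
  proof (intro ext)
    fix x n
    show "cayley_act s x n = F x n"
      unfolding F_def by (cases n) (simp_all add: cayley_act_0 cayley_act_Suc const)
  qed
  have idem: "F \<circ> F = F"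
    unfolding F_def by (intro ext) (simp add: mult.assoc[symmetric], rule const)
  have "f = F" if "f \<in> cayley_semigroup TYPE('a)" for f
    using that by (induction rule: cayley_semigroup_induct) (simp_all only: act idem)
  then have "cayley_semigroup TYPE('a) = {F}"
    using cayley_act_in_cayley_semigroup[of undefined] unfolding act by blast
  then show ?thesis by simp
qed

text \<open>The sole element is idempotent and serves as its own neutral element, even if it is not
  the identity map.\<close>

lemma group_if_card_cayley_semigroup:
  assumes "card (cayley_semigroup TYPE('a::semigroup_mult)) = 1"
  shows "trans_semigroup_is_group (cayley_semigroup TYPE('a))"
proof -
  obtain f where f: "cayley_semigroup TYPE('a) = {f}"
    using assms card_1_singletonE by blast
  then have "f \<circ> f = f" using comp_in_cayley_semigroup by blast
  then have "group \<lparr>carrier = {f}, monoid.mult = trans_mult, one = f\<rparr>"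
    by (intro groupI) (auto simp: trans_mult_def)
  then show ?thesis unfolding trans_semigroup_is_group_def f by blast
qed

theorem theorem1p2:
  shows "(trans_semigroup_is_group (cayley_semigroup TYPE('a::{finite, semigroup_mult}))
            \<longleftrightarrow> card (cayley_semigroup TYPE('a)) = 1) \<and>
         (card (cayley_semigroup TYPE('a)) = 1
            \<longleftrightarrow> (\<exists>T :: 'a set. right_zero T \<and> inflation_by_null_semigroups T))"
  using right_zero_inflation_if_group card_cayley_semigroup_if_inflation
    group_if_card_cayley_semigroup by blast

end
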